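(* Let $q=p^m>4$ be a prime power ($p$ prime) and let $0\le e\le m-1$. If there exists an $[n,k]_q$ GRS code with $l$-dimensional $e$-Galois hull, where $0\le l\le k$, then for any $1\le i\le\min\{l,q+1-n\}$ and each $0\le s\le l-i$ there exists an $[n+i,k]_q$ MDS code with $s$-dimensional $e$-Galois hull.
   Context: For $\bm x,\bm y\in\mathbb F_q^n$, the $e$-Galois inner product is $\langle\bm x,\bm y\rangle_e=\sum_{i=1}^n x_iy_i^{p^e}$. For a linear code $\mathcal C\subseteq\mathbb F_q^n$, $\mathcal C^{\perp_e}=\{\bm x\in\mathbb F_q^n:\langle\bm y,\bm x\rangle_e=0\ \text{for all }\bm y\in\mathcal C\}$ and the $e$-Galois hull is $\mathrm{Hull}_e(\mathcal C)=\mathcal C\cap\mathcal C^{\perp_e}$. An $[n,k]_q$ GRS code ($1\le k\le n$) is a code $\{(v_1f(a_1),\dots,v_nf(a_n)):f\in\mathbb F_q[x],\deg f\le k-1\}$ with distinct $a_j\in\mathbb F_q$ and $v_j\in\mathbb F_q^*$. An $[n,k]$ code is MDS if its minimum distance is $n-k+1$. *)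

theory Defs
  imports "Jordan_Normal_Form.VS_Connect" "HOL-Computational_Algebra.Primes"
begin

definition code_dim :: "nat \<Rightarrow> 'a::field vec set \<Rightarrow> nat" where
  "code_dim n C = vectorspace.dim class_ring ((module_vec TYPE('a) n)\<lparr>carrier := C\<rparr>)"

definition linear_code :: "nat \<Rightarrow> nat \<Rightarrow> 'a::field vec set \<Rightarrow> bool" where
  "linear_code n k C \<longleftrightarrow>
     VectorSpace.subspace class_ring C (module_vec TYPE('a) n) \<and> code_dim n C = k"

definition hamming_dist :: "'a vec \<Rightarrow> 'a vec \<Rightarrow> nat" where
  "hamming_dist x y = card {j. j < dim_vec x \<and> x $ j \<noteq> y $ j}"

(* Only meaningful for codes with at least two words; Min is unspecified on the empty set. *)
definition min_dist :: "'a vec set \<Rightarrow> nat" where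
  "min_dist C = Min {hamming_dist x y | x y. x \<in> C \<and> y \<in> C \<and> x \<noteq> y}"

definition mds_code :: "nat \<Rightarrow> nat \<Rightarrow> 'a::field vec set \<Rightarrow> bool" where
  "mds_code n k C \<longleftrightarrow> linear_code n k C \<and> min_dist C = n - k + 1"

(* p stands for the characteristic of the field. *)
definition galois_inner :: "nat \<Rightarrow> nat \<Rightarrow> 'a::field vec \<Rightarrow> 'a vec \<Rightarrow> 'a" where
  "galois_inner p e x y = (\<Sum>j<dim_vec x. x $ j * (y $ j) ^ (p ^ e))"

definition galois_dual :: "nat \<Rightarrow> nat \<Rightarrow> nat \<Rightarrow> 'a::field vec set \<Rightarrow> 'a vec set" where
  "galois_dual p e n C = {x \<in> carrier_vec n. \<forall>y\<in>C. galois_inner p e y x = 0}"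

definition galois_hull :: "nat \<Rightarrow> nat \<Rightarrow> nat \<Rightarrow> 'a::field vec set \<Rightarrow> 'a vec set" where
  "galois_hull p e n C = C \<inter> galois_dual p e n C"

(* The zero polynomial has degree 0 here, so it satisfies the degree bound, as intended. *)
definition grs_code :: "nat \<Rightarrow> nat \<Rightarrow> 'a::field vec set \<Rightarrow> bool" where
  "grs_code n k C \<longleftrightarrow> 1 \<le> k \<and> k \<le> n \<and>
     (\<exists>a v :: nat \<Rightarrow> 'a. inj_on a {..<n} \<and> (\<forall>j<n. v j \<noteq> 0) \<and>
        C = {vec n (\<lambda>j. v j * poly f (a j)) | f. degree f \<le> k - 1})"

end

theory Submission
  imports Defs "HOL-Library.Cardinality" "HOL-Number_Theory.Residues"
begin

text \<open>
  Extend the GRS code by \<open>i - 1\<close> further points of the affine line and by the point at infinity; the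
  result is MDS and its hull has dimension at least \<open>l - i\<close>, since each new coordinate costs at most
  one. It remains to lower the hull dimension of an MDS code \<open>C\<close> by exactly one. A nonzero hull word
  \<open>r\<close> has fewer than \<open>k\<close> zeros, and a nonzero word \<open>t\<close> of the left radical of the Galois form on
  \<open>C\<close> has weight greater than \<open>k\<close>, because the dual of an MDS code is MDS; so \<open>r\<close> and \<open>t\<close> are both
  nonzero at some coordinate \<open>j\<close>. Scaling that coordinate by \<open>\<alpha>\<close> with \<open>\<alpha> ^ (1 + p ^ e) \<noteq> 1\<close> is a
  rank-one perturbation of the form which cuts the hull down to its words vanishing at \<open>j\<close>. Such an
  \<open>\<alpha>\<close> exists as \<open>q > 4\<close>. Dimensions are handled through cardinalities, \<open>card W = q ^ dim W\<close>.
\<close>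

section \<open>Vector subspaces over a finite field, measured by cardinality\<close>

lemma subspace_vec_iff:
  "VectorSpace.subspace class_ring W (module_vec TYPE('a::field) n) \<longleftrightarrow>
     W \<subseteq> carrier_vec n \<and> 0\<^sub>v n \<in> W \<and> (\<forall>x\<in>W. \<forall>y\<in>W. x + y \<in> W) \<and> (\<forall>c. \<forall>x\<in>W. c \<cdot>\<^sub>v x \<in> W)"
  using vec_vs[where 'a = 'a, of n] vec_module[where 'a = 'a, of n]
  unfolding VectorSpace.subspace_def submodule_def
  by (auto simp: module_vec_def)

abbreviation vec_subspace :: "nat \<Rightarrow> 'a::field vec set \<Rightarrow> bool" where
  "vec_subspace n W \<equiv> VectorSpace.subspace class_ring W (module_vec TYPE('a) n)"

lemma finite_carrier_vec: "finite (carrier_vec n :: 'a::finite vec set)"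
proof -
  have "carrier_vec n \<subseteq> vec_of_list ` {xs::'a list. set xs \<subseteq> UNIV \<and> length xs = n}"
    by (rule subsetI, rule_tac x = "list_of_vec x" in image_eqI) (auto simp: vec_list)
  then show ?thesis
    by (rule finite_subset) (intro finite_imageI finite_lists_length_eq, simp)
qed

lemma vec_subspace_finite:
  assumes "vec_subspace n (W :: 'a::{field,finite} vec set)"
  shows "finite W"
  using assms finite_subset[OF _ finite_carrier_vec] by (auto simp: subspace_vec_iff)

text \<open>A basis \<open>B\<close> identifies \<open>W\<close> with the coefficient functions on
  \<open>B\<close>, of which there are \<open>CARD('a) ^ card B\<close>. Every later dimension
  argument goes through this count.\<close>

lemma card_vec_subspace:
  assumes W: "vec_subspace n (W :: 'a::{field,finite} vec set)"
  shows "card W = CARD('a) ^ code_dim n W"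
proof -
  let ?V = "(module_vec TYPE('a) n)\<lparr>carrier := W\<rparr>"
  have vs: "vectorspace class_ring ?V"
    using vectorspace.subspace_is_vs[OF vec_vs W] .
  interpret vectorspace class_ring ?V by (rule vs)
  \<comment> \<open>The finite set \<open>W\<close> spans itself, so a finite basis can be
    extracted.\<close>
  have "fin_dim"
    unfolding fin_dim_def
    using vec_subspace_finite[OF W] in_own_span[of W] span_closed[of W]
    by (intro exI[of _ W]) auto
  then obtain B where B: "finite B" "basis B" using finite_basis_exists by blast
  have BW: "B \<subseteq> W" using B(2) by (simp add: basis_def)
  have ex1: "\<And>v. v \<in> W \<Longrightarrow> \<exists>!a. a \<in> B \<rightarrow>\<^sub>E UNIV \<and> lincomb a B = v"
    using basis_criterion[OF B(1)] BW B(2) by auto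
  have "bij_betw (\<lambda>a. lincomb a B) (B \<rightarrow>\<^sub>E UNIV) W"
    unfolding bij_betw_def
  proof
    have closed: "lincomb a B \<in> W" if "a \<in> B \<rightarrow>\<^sub>E UNIV" for a
      using lincomb_closed[of B a] BW by auto
    show "inj_on (\<lambda>a. lincomb a B) (B \<rightarrow>\<^sub>E UNIV)"
      using ex1 closed by (intro inj_onI) metis
    show "(\<lambda>a. lincomb a B) ` (B \<rightarrow>\<^sub>E UNIV) = W"
      using ex1 closed by (auto simp: image_iff) metis
  qed
  then have "card W = card (B \<rightarrow>\<^sub>E (UNIV :: 'a set))"
    by (simp add: bij_betw_same_card)
  also have "\<dots> = CARD('a) ^ card B"
    using B(1) by (simp add: card_PiE)
  finally show ?thesis
    using dim_basis[OF B] by (simp add: code_dim_def)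
qed

lemma card_field_gt_1: "1 < CARD('a::{field,finite})"
proof -
  have "card {0, 1 :: 'a} \<le> CARD('a)" by (intro card_mono) auto
  then show ?thesis by simp
qed

lemma code_dim_eqI:
  assumes "vec_subspace n (W :: 'a::{field,finite} vec set)" "card W = CARD('a) ^ d"
  shows "code_dim n W = d"
  using assms card_vec_subspace[OF assms(1)] card_field_gt_1[where 'a = 'a] by simp

text \<open>The exponent \<open>r\<close> covers both arguments of the Galois form, which is linear
  in the first and semilinear in the second.\<close>

lemma card_semilinear_kernel:
  fixes W :: "'a::{field,finite} vec set" and \<phi> :: "'a vec \<Rightarrow> 'a"
  assumes W: "vec_subspace n W"
    and add: "\<And>x y. x \<in> W \<Longrightarrow> y \<in> W \<Longrightarrow> \<phi> (x + y) = \<phi> x + \<phi> y"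
    and smult: "\<And>c x. x \<in> W \<Longrightarrow> \<phi> (c \<cdot>\<^sub>v x) = c ^ r * \<phi> x"
    and surj: "surj (\<lambda>c::'a. c ^ r)"
    and nz: "w \<in> W" "\<phi> w \<noteq> 0"
  shows "card W = CARD('a) * card {x \<in> W. \<phi> x = 0}"
proof -
  note Wc = W[unfolded subspace_vec_iff]
  have "\<exists>x\<in>W. \<phi> x = c" for c
  proof -
    \<comment> \<open>An \<open>r\<close>-th root of the required factor rescales \<open>w\<close>
      to a vector of value \<open>c\<close>.\<close>
    obtain d where "d ^ r = c / \<phi> w" using surj by (metis surjD)
    then show ?thesis using nz Wc smult[of w d] by (intro bexI[of _ "d \<cdot>\<^sub>v w"]) auto
  qed
  then obtain g where g: "\<And>c. g c \<in> W" "\<And>c. \<phi> (g c) = c" by metis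
  let ?K = "{x \<in> W. \<phi> x = 0}"
  \<comment> \<open>Since \<open>g\<close> picks one vector for each value, \<open>W\<close> is the
    disjoint union of the translates of the kernel by \<open>g c\<close>, one for each field element
    \<open>c\<close>.\<close>
  have "bij_betw (\<lambda>(c, x). x + g c) (UNIV \<times> ?K) W"
    unfolding bij_betw_def
  proof
    show "inj_on (\<lambda>(c, x). x + g c) (UNIV \<times> ?K)"
    proof (rule inj_onI, clarsimp)
      fix c x d y
      assume *: "x \<in> W" "\<phi> x = 0" "y \<in> W" "\<phi> y = 0" "x + g c = y + g d"
      then have "c = d" using add[OF *(1) g(1)[of c]] add[OF *(3) g(1)[of d]] g by simp
      moreover have "x = y"
      proof (rule eq_vecI)
        show "dim_vec x = dim_vec y" using * Wc by (metis carrier_vecD subsetD)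
        fix i assume i: "i < dim_vec y"
        then have "i < dim_vec (g d)" using * Wc g(1) by (metis carrier_vecD subsetD)
        then show "x $ i = y $ i"
          using arg_cong[OF *(5), of "\<lambda>v. v $ i"] i \<open>c = d\<close> by simp
      qed
      ultimately show "c = d \<and> x = y" by simp
    qed
    show "(\<lambda>(c, x). x + g c) ` (UNIV \<times> ?K) = W"
    proof
      show "(\<lambda>(c, x). x + g c) ` (UNIV \<times> ?K) \<subseteq> W" using Wc g by auto
      show "W \<subseteq> (\<lambda>(c, x). x + g c) ` (UNIV \<times> ?K)"
      proof
        fix x assume x: "x \<in> W"
        let ?y = "x + (- 1) \<cdot>\<^sub>v g (\<phi> x)"
        have y: "?y \<in> W" using x g Wc by auto
        have eq: "?y + g (\<phi> x) = x"
        proof (rule eq_vecI)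
          have "x \<in> carrier_vec n" "g (\<phi> x) \<in> carrier_vec n" using x g(1) Wc by blast+
          then show "\<And>i. i < dim_vec x \<Longrightarrow> (?y + g (\<phi> x)) $ i = x $ i"
            and "dim_vec (?y + g (\<phi> x)) = dim_vec x" by auto
        qed
        have "\<phi> ?y + \<phi> x = \<phi> x" using add[OF y g(1)[of "\<phi> x"]] eq g by simp
        then show "x \<in> (\<lambda>(c, x). x + g c) ` (UNIV \<times> ?K)"
          using y eq by (intro image_eqI[of _ _ "(\<phi> x, ?y)"]) auto
      qed
    qed
  qed
  from bij_betw_same_card[OF this] show ?thesis by (simp add: card_cartesian_product)
qed

lemma card_coord_kernel:
  fixes W :: "'a::{field,finite} vec set"
  assumes W: "vec_subspace n W" and j: "j < n" and w: "w \<in> W" "w $ j \<noteq> 0"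
  shows "card W = CARD('a) * card {x \<in> W. x $ j = 0}"
proof (rule card_semilinear_kernel[where r = 1, OF W])
  have dim: "dim_vec x = n" if "x \<in> W" for x using that W unfolding subspace_vec_iff by auto
  fix x y c assume "x \<in> W"
  then show "(c \<cdot>\<^sub>v x) $ j = c ^ 1 * x $ j" using dim j by simp
  assume "y \<in> W"
  then show "(x + y) $ j = x $ j + y $ j" using dim j by simp
qed (use w in \<open>simp_all add: surj_def\<close>)

lemma vec_subspace_vanishing:
  assumes "vec_subspace n W" "J \<subseteq> {..<n}"
  shows "vec_subspace n {x \<in> W. \<forall>j\<in>J. x $ j = 0}"
proof -
  have dim: "dim_vec x = n" if "x \<in> W" for x using that assms(1) unfolding subspace_vec_iff by auto
  have "x $ j = 0 \<Longrightarrow> y $ j = 0 \<Longrightarrow> (x + y) $ j = 0" "x $ j = 0 \<Longrightarrow> (c \<cdot>\<^sub>v x) $ j = 0"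
    if "x \<in> W" "y \<in> W" "j \<in> J" for x y j c
    using that dim assms(2) by auto
  moreover have "0\<^sub>v n $ j = 0" if "j \<in> J" for j using that assms(2) by auto
  ultimately show ?thesis using assms(1) unfolding subspace_vec_iff by blast
qed

text \<open>Each coordinate either vanishes on what is left of \<open>W\<close> or cuts its size by
  the factor \<open>CARD('a)\<close>, so induction on \<open>J\<close> loses at most one factor per
  coordinate.\<close>

lemma card_vanishing:
  fixes W :: "'a::{field,finite} vec set"
  assumes W: "vec_subspace n W" and J: "J \<subseteq> {..<n}"
  shows "card W \<le> CARD('a) ^ card J * card {x \<in> W. \<forall>j\<in>J. x $ j = 0}"
proof -
  have "finite J" using J finite_subset by blast
  then show ?thesis using J
  proof (induction J)
    case (insert j J)
    let ?U = "{x \<in> W. \<forall>j\<in>J. x $ j = 0}"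
    have U: "vec_subspace n ?U" using W insert.prems by (intro vec_subspace_vanishing) auto
    have eq: "{x \<in> W. \<forall>j\<in>insert j J. x $ j = 0} = {x \<in> ?U. x $ j = 0}" by auto
    have "card ?U \<le> CARD('a) * card {x \<in> ?U. x $ j = 0}"
    proof (cases "\<exists>w\<in>?U. w $ j \<noteq> 0")
      case True
      then show ?thesis using card_coord_kernel[OF U, of j] insert.prems by auto
    next
      case False
      then have "{x \<in> ?U. x $ j = 0} = ?U" by auto
      then show ?thesis using card_field_gt_1[where 'a = 'a] by simp
    qed
    then have "CARD('a) ^ card J * card ?U \<le> CARD('a) ^ card J * (CARD('a) * card {x \<in> ?U. x $ j = 0})"
      by (rule mult_le_mono2)
    moreover have "card W \<le> CARD('a) ^ card J * card ?U" using insert by simp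
    ultimately have "card W \<le> CARD('a) ^ card J * (CARD('a) * card {x \<in> ?U. x $ j = 0})"
      by (rule order_trans[rotated])
    also have "\<dots> = CARD('a) ^ card (insert j J) * card {x \<in> ?U. x $ j = 0}"
      using insert.hyps by simp
    finally show ?case unfolding eq .
  qed simp
qed

section \<open>Frobenius powers and the Galois inner product\<close>

lemma prime_CHAR_finite: "prime CHAR('a::{field,finite})"
  by (intro prime_CHAR_semidom finite_imp_CHAR_pos) simp

lemma frobenius_additive:
  assumes "p = CHAR('a::{field,finite})"
  shows "(x + y :: 'a) ^ p ^ e = x ^ p ^ e + y ^ p ^ e"
  using assms by (intro freshmans_dream'[of _ e] prime_CHAR_finite) simp

text \<open>An additive map with trivial kernel is injective, and an injective self-map of a finite
  set is onto.\<close>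

lemma frobenius_surj:
  assumes "p = CHAR('a::{field,finite})"
  shows "surj (\<lambda>c::'a. c ^ p ^ e)"
proof -
  have "inj (\<lambda>c::'a. c ^ p ^ e)"
  proof (rule injI)
    fix x y :: 'a
    assume "x ^ p ^ e = y ^ p ^ e"
    moreover have "x ^ p ^ e = (x - y) ^ p ^ e + y ^ p ^ e"
      using frobenius_additive[OF assms, of "x - y" y e] by simp
    ultimately show "x = y" by simp
  qed
  then show ?thesis by (rule finite_UNIV_inj_surj[rotated]) simp
qed

text \<open>The characteristic is a prime dividing \<open>p ^ m\<close>. This ties the parameter
  \<open>p\<close> of the Galois form to the field, which makes the power map in the form
  additive.\<close>

lemma CHAR_eq_of_card:
  assumes "prime p" "CARD('a::{field,finite}) = p ^ m"
  shows "CHAR('a) = p"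
proof -
  have "CHAR('a) dvd p ^ m" using CHAR_dvd_CARD[where 'a = 'a] assms by simp
  then show ?thesis
    using assms(1) prime_CHAR_finite[where 'a = 'a] by (meson prime_dvd_power primes_dvd_imp_eq)
qed

lemma galois_hull_iff:
  assumes "C \<subseteq> carrier_vec n"
  shows "x \<in> galois_hull p e n C \<longleftrightarrow> x \<in> C \<and> (\<forall>y\<in>C. galois_inner p e y x = 0)"
  using assms by (auto simp: galois_hull_def galois_dual_def)

lemma galois_inner_add_left:
  assumes "x \<in> carrier_vec n" "y \<in> carrier_vec n"
  shows "galois_inner p e (x + y) z = galois_inner p e x z + galois_inner p e y z"
proof -
  have "galois_inner p e (x + y) z = (\<Sum>j<n. x $ j * z $ j ^ p ^ e + y $ j * z $ j ^ p ^ e)"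
    using assms unfolding galois_inner_def by (intro sum.cong) (auto simp: distrib_right)
  then show ?thesis using assms by (simp add: galois_inner_def sum.distrib)
qed

lemma galois_inner_smult_left:
  "galois_inner p e (c \<cdot>\<^sub>v x) z = c * galois_inner p e x z"
  by (simp add: galois_inner_def sum_distrib_left mult.assoc)

lemma galois_inner_add_right:
  assumes "p = CHAR('a::{field,finite})"
    and "x \<in> carrier_vec n" "y \<in> carrier_vec n" "z \<in> carrier_vec n"
  shows "galois_inner p e z (x + y :: 'a vec) = galois_inner p e z x + galois_inner p e z y"
proof -
  have "galois_inner p e z (x + y) = (\<Sum>j<n. z $ j * x $ j ^ p ^ e + z $ j * y $ j ^ p ^ e)"
    using assms(2-4) unfolding galois_inner_def
    by (intro sum.cong) (auto simp: frobenius_additive[OF assms(1)] distrib_left)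
  then show ?thesis using assms(2-4) by (simp add: galois_inner_def sum.distrib)
qed

lemma galois_inner_smult_right:
  assumes "x \<in> carrier_vec n" "z \<in> carrier_vec n"
  shows "galois_inner p e z (c \<cdot>\<^sub>v x) = c ^ p ^ e * galois_inner p e z x"
proof -
  have "galois_inner p e z (c \<cdot>\<^sub>v x) = (\<Sum>j<n. c ^ p ^ e * (z $ j * x $ j ^ p ^ e))"
    using assms unfolding galois_inner_def
    by (intro sum.cong) (auto simp: power_mult_distrib mult.left_commute)
  then show ?thesis using assms by (simp add: galois_inner_def sum_distrib_left)
qed

text \<open>The hull is cut out of \<open>C\<close> by conditions on the second argument of the
  form, in which the form is additive and semilinear.\<close>

lemma vec_subspace_galois_hull:
  assumes p: "p = CHAR('a::{field,finite})" and C: "vec_subspace n (C :: 'a vec set)"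
  shows "vec_subspace n (galois_hull p e n C)"
proof -
  note Cc = C[unfolded subspace_vec_iff]
  have C': "C \<subseteq> carrier_vec n" using Cc by blast
  have "p > 0" using p prime_CHAR_finite[where 'a = 'a] by (simp add: prime_gt_0_nat)
  then have "galois_inner p e y (0\<^sub>v n) = 0" if "y \<in> C" for y
    using that C' by (auto simp: galois_inner_def)
  then show ?thesis
    using Cc galois_inner_add_right[OF p, of _ n _ _ e] galois_inner_smult_right[where 'a = 'a and n = n and p = p and e = e]
    unfolding subspace_vec_iff by (simp add: galois_hull_iff[OF C'] subset_iff)
qed

section \<open>Left and right radicals of the Galois form\<close>

text \<open>A row \<open>y\<close> in the radical holds \<open>card C\<close> pairs, and every other
  row holds \<open>card C\<close> divided by \<open>q\<close>. Multiplying by \<open>q\<close>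
  avoids the division, and working in the integers makes \<open>q - 1\<close> a genuine
  difference.\<close>

lemma card_pairing:
  fixes R :: "'b \<Rightarrow> 'b \<Rightarrow> bool"
  assumes "finite C" and "\<And>y. y \<in> C \<Longrightarrow> \<not> (\<forall>x\<in>C. R y x) \<Longrightarrow> card C = q * card {x \<in> C. R y x}"
  shows "int q * card {(y, x) \<in> C \<times> C. R y x} =
    int (card C) ^ 2 + (int q - 1) * card C * card {y \<in> C. \<forall>x\<in>C. R y x}"
proof -
  let ?L = "{y \<in> C. \<forall>x\<in>C. R y x}"
  have "{(y, x) \<in> C \<times> C. R y x} = (SIGMA y:C. {x \<in> C. R y x})" by auto
  then have "int q * card {(y, x) \<in> C \<times> C. R y x} = (\<Sum>y\<in>C. int q * card {x \<in> C. R y x})"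
    using assms(1) by (simp add: card_SigmaI sum_distrib_left)
  also have "\<dots> = (\<Sum>y\<in>C. card C + (if y \<in> ?L then (int q - 1) * card C else 0))"
  proof (rule sum.cong)
    fix y assume y: "y \<in> C"
    show "int q * card {x \<in> C. R y x} = card C + (if y \<in> ?L then (int q - 1) * card C else 0)"
    proof (cases "\<forall>x\<in>C. R y x")
      case True
      then have "{x \<in> C. R y x} = C" by auto
      then show ?thesis using True y by (simp add: algebra_simps)
    qed (use assms(2)[OF y] in auto)
  qed simp
  also have "\<dots> = int (card C) ^ 2 + (\<Sum>y\<in>C. if y \<in> ?L then (int q - 1) * card C else 0)"
    by (simp add: sum.distrib power2_eq_square)
  also have "(\<Sum>y\<in>C. if y \<in> ?L then (int q - 1) * card C else 0) = (\<Sum>y\<in>?L. (int q - 1) * card C)"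
    using assms(1) by (intro sum.mono_neutral_cong_right) auto
  finally show ?thesis by (simp add: algebra_simps)
qed

text \<open>Counting the orthogonal pairs of \<open>C \<times> C\<close> by rows and by columns shows that the left and right
  radicals of the form have the same size.\<close>

lemma card_left_radical:
  assumes p: "p = CHAR('a::{field,finite})" and C: "vec_subspace n (C :: 'a vec set)"
  shows "card {y \<in> C. \<forall>x\<in>C. galois_inner p e y x = 0} = card (galois_hull p e n C)"
proof -
  let ?q = "CARD('a)"
  have C': "\<And>x. x \<in> C \<Longrightarrow> x \<in> carrier_vec n" and "0\<^sub>v n \<in> C" using C unfolding subspace_vec_iff by auto
  then have fin: "finite C" and pos: "card C > 0" using vec_subspace_finite[OF C] by (auto simp: card_gt_0_iff)
  have row: "card C = ?q * card {x \<in> C. galois_inner p e y x = 0}"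
    if y: "y \<in> C" "\<not> (\<forall>x\<in>C. galois_inner p e y x = 0)" for y
  proof -
    from y obtain w where w: "w \<in> C" "galois_inner p e y w \<noteq> 0" by blast
    show ?thesis
    proof (rule card_semilinear_kernel[OF C, where r = "p ^ e"])
      show "surj (\<lambda>c::'a. c ^ p ^ e)" by (rule frobenius_surj[OF p])
      fix u v c assume u: "u \<in> C"
      show "galois_inner p e y (c \<cdot>\<^sub>v u) = c ^ p ^ e * galois_inner p e y u"
        by (rule galois_inner_smult_right[OF C'[OF u] C'[OF y(1)]])
      assume v: "v \<in> C"
      show "galois_inner p e y (u + v) = galois_inner p e y u + galois_inner p e y v"
        by (rule galois_inner_add_right[OF p C'[OF u] C'[OF v] C'[OF y(1)]])
    qed (fact w)+
  qed
  have col: "card C = ?q * card {y \<in> C. galois_inner p e y x = 0}"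
    if x: "x \<in> C" "\<not> (\<forall>y\<in>C. galois_inner p e y x = 0)" for x
  proof -
    from x obtain w where w: "w \<in> C" "galois_inner p e w x \<noteq> 0" by blast
    show ?thesis
    proof (rule card_semilinear_kernel[OF C, where r = 1])
      show "surj (\<lambda>c::'a. c ^ 1)" by (simp add: surj_def)
      fix u v c assume u: "u \<in> C"
      show "galois_inner p e (c \<cdot>\<^sub>v u) x = c ^ 1 * galois_inner p e u x"
        by (simp add: galois_inner_smult_left)
      assume v: "v \<in> C"
      show "galois_inner p e (u + v) x = galois_inner p e u x + galois_inner p e v x"
        by (rule galois_inner_add_left[OF C'[OF u] C'[OF v]])
    qed (fact w)+
  qed
  have swap: "{(x, y) \<in> C \<times> C. galois_inner p e y x = 0} =
      prod.swap ` {(y, x) \<in> C \<times> C. galois_inner p e y x = 0}"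
    by (auto simp: image_iff)
  have "card {(x, y) \<in> C \<times> C. galois_inner p e y x = 0} = card {(y, x) \<in> C \<times> C. galois_inner p e y x = 0}"
    unfolding swap by (rule card_image) simp
  \<comment> \<open>The row count and the column count agree, and their common square of
    \<open>card C\<close> cancels, leaving equal multiples of the sizes of the two radicals.\<close>
  then have "(int ?q - 1) * card C * card {y \<in> C. \<forall>x\<in>C. galois_inner p e y x = 0} =
      (int ?q - 1) * card C * card {x \<in> C. \<forall>y\<in>C. galois_inner p e y x = 0}"
    using card_pairing[OF fin row] card_pairing[where R = "\<lambda>x y. galois_inner p e y x = 0", OF fin col]
    by simp
  moreover have "int ?q - 1 \<noteq> 0" using card_field_gt_1[where 'a = 'a] by linarith
  ultimately have "card {y \<in> C. \<forall>x\<in>C. galois_inner p e y x = 0} =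
      card {x \<in> C. \<forall>y\<in>C. galois_inner p e y x = 0}"
    using pos by simp
  moreover have "galois_hull p e n C = {x \<in> C. \<forall>y\<in>C. galois_inner p e y x = 0}"
    using C' by (auto simp: galois_hull_iff subset_iff)
  ultimately show ?thesis by simp
qed

section \<open>MDS codes described by the zeros of their words\<close>

text \<open>For \<open>k \<le> n\<close>, fewer than \<open>k\<close> zeros in a nonzero word means
  weight at least \<open>n - k + 1\<close>. This form of the MDS property involves neither
  \<open>Min\<close> nor the dimension of a vector space.\<close>

definition mds_space :: "nat \<Rightarrow> nat \<Rightarrow> 'a::{field,finite} vec set \<Rightarrow> bool" where
  "mds_space n k C \<longleftrightarrow> vec_subspace n C \<and> card C = CARD('a) ^ k \<and>
     (\<forall>x\<in>C. x \<noteq> 0\<^sub>v n \<longrightarrow> card {j. j < n \<and> x $ j = 0} < k)"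

text \<open>Vanishing on \<open>J\<close> costs at most \<open>card J\<close> factors
  \<open>CARD('a)\<close> out of \<open>k\<close>, so more than the zero word remains.\<close>

lemma mds_space_vanishing_word:
  fixes C :: "'a::{field,finite} vec set"
  assumes C: "mds_space n k C" and J: "J \<subseteq> {..<n}" "card J < k"
  obtains x where "x \<in> C" "x \<noteq> 0\<^sub>v n" "\<forall>j\<in>J. x $ j = 0"
proof -
  let ?U = "{x \<in> C. \<forall>j\<in>J. x $ j = 0}"
  have sub: "vec_subspace n C" and card: "card C = CARD('a) ^ k" using C by (auto simp: mds_space_def)
  have "?U \<noteq> {0\<^sub>v n}"
  proof
    assume "?U = {0\<^sub>v n}"
    then have "CARD('a) ^ k \<le> CARD('a) ^ card J" using card_vanishing[OF sub J(1)] card by simp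
    then show False using card_field_gt_1[where 'a = 'a] J(2) by simp
  qed
  moreover have "0\<^sub>v n \<in> ?U" using vec_subspace_vanishing[OF sub J(1)] by (simp add: subspace_vec_iff)
  ultimately show thesis using that by blast
qed

lemma card_support:
  "card {j. j < n \<and> x $ j \<noteq> 0} + card {j. j < n \<and> x $ j = 0} = n"
proof -
  have "card {j. j < n \<and> x $ j \<noteq> 0} + card {j. j < n \<and> x $ j = 0} =
      card ({j. j < n \<and> x $ j \<noteq> 0} \<union> {j. j < n \<and> x $ j = 0})"
    by (subst card_Un_disjoint) auto
  also have "{j. j < n \<and> x $ j \<noteq> 0} \<union> {j. j < n \<and> x $ j = 0} = {..<n}" by auto
  finally show ?thesis by simp
qed

text \<open>Counting the zeros of a difference of two words bounds their distance from below. A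
  nonzero word vanishing at \<open>k - 1\<close> prescribed positions attains the bound.\<close>

lemma mds_code_of_mds_space:
  fixes C :: "'a::{field,finite} vec set"
  assumes C: "mds_space n k C" and k: "1 \<le> k" "k \<le> n"
  shows "mds_code n k C"
proof -
  have sub: "vec_subspace n C" and card: "card C = CARD('a) ^ k"
    and zeros: "\<And>x. x \<in> C \<Longrightarrow> x \<noteq> 0\<^sub>v n \<Longrightarrow> card {j. j < n \<and> x $ j = 0} < k"
    using C by (auto simp: mds_space_def)
  note subc = sub[unfolded subspace_vec_iff]
  let ?S = "{hamming_dist x y |x y. x \<in> C \<and> y \<in> C \<and> x \<noteq> y}"
  have "Min ?S = n - k + 1"
  proof (rule Min_eqI)
    have "?S \<subseteq> (\<lambda>(x, y). hamming_dist x y) ` (C \<times> C)" by auto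
    then show "finite ?S" using vec_subspace_finite[OF sub] finite_subset by blast
  next
    fix d assume "d \<in> ?S"
    then obtain x y where xy: "x \<in> C" "y \<in> C" "x \<noteq> y" "d = hamming_dist x y" by blast
    have dim: "x \<in> carrier_vec n" "y \<in> carrier_vec n" using xy subc by auto
    let ?z = "x + (- 1) \<cdot>\<^sub>v y"
    have z: "?z \<in> C" using xy subc by blast
    have zj: "?z $ j = x $ j - y $ j" if "j < n" for j using that dim by auto
    have "?z \<noteq> 0\<^sub>v n"
    proof
      assume "?z = 0\<^sub>v n"
      then have "x $ j = y $ j" if "j < n" for j using zj[OF that] that by simp
      then show False using xy(3) dim by (metis carrier_vecD eq_vecI)
    qed
    then have "card {j. j < n \<and> ?z $ j = 0} < k" using zeros z by blast
    moreover have "d = card {j. j < n \<and> ?z $ j \<noteq> 0}"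
      unfolding xy(4) hamming_dist_def using dim zj
      by (intro arg_cong[of _ _ card] Collect_cong) auto
    ultimately show "n - k + 1 \<le> d" using card_support[of n ?z] k by linarith
  next
    obtain x where x: "x \<in> C" "x \<noteq> 0\<^sub>v n" "\<forall>j\<in>{..<k - 1}. x $ j = 0"
      by (rule mds_space_vanishing_word[OF C, of "{..<k - 1}"]) (use k in auto)
    have xc: "x \<in> carrier_vec n" using x subc by blast
    have "card {..<k - 1} \<le> card {j. j < n \<and> x $ j = 0}"
      using x k by (intro card_mono) auto
    \<comment> \<open>There are at least \<open>k - 1\<close> zeros by construction and fewer than
      \<open>k\<close> by the MDS property.\<close>
    then have "card {j. j < n \<and> x $ j = 0} = k - 1" using zeros[OF x(1,2)] by simp
    then have "card {j. j < n \<and> x $ j \<noteq> 0} = n - k + 1" using card_support[of n x] k by linarith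
    moreover have "hamming_dist x (0\<^sub>v n) = card {j. j < n \<and> x $ j \<noteq> 0}"
      unfolding hamming_dist_def using xc by (intro arg_cong[of _ _ card] Collect_cong) auto
    ultimately have "n - k + 1 = hamming_dist x (0\<^sub>v n)" by simp
    moreover have "0\<^sub>v n \<in> C" using subc by blast
    ultimately show "n - k + 1 \<in> ?S" using x(1,2) by blast
  qed
  then show ?thesis
    using sub code_dim_eqI[OF sub card] by (simp add: mds_code_def linear_code_def min_dist_def)
qed

text \<open>If the support of \<open>t\<close> fitted into a set \<open>T\<close> of
  \<open>k\<close> positions, some code word would vanish on \<open>T\<close> except at one position
  \<open>i\<close> of that support. Its product with \<open>t\<close> would then be a single nonzero
  term.\<close>

lemma mds_space_dual_support:
  fixes C :: "'a::{field,finite} vec set"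
  assumes C: "mds_space n k C" and k: "1 \<le> k" "k \<le> n"
    and t: "t \<in> carrier_vec n" "t \<noteq> 0\<^sub>v n" and orth: "\<forall>x\<in>C. galois_inner p e t x = 0" and p: "p > 0"
  shows "k < card {j. j < n \<and> t $ j \<noteq> 0}"
proof (rule ccontr)
  let ?S = "{j. j < n \<and> t $ j \<noteq> 0}"
  assume "\<not> k < card ?S"
  \<comment> \<open>The support is enlarged to exactly \<open>k\<close> positions, which
    \<open>k \<le> n\<close> allows.\<close>
  then obtain T where T: "?S \<subseteq> T" "T \<subseteq> {..<n}" "card T = k"
    using exists_subset_between[of ?S k "{..<n}"] k by auto
  obtain i where i: "i < n" "t $ i \<noteq> 0" using t by (metis carrier_vecD eq_vecI index_zero_vec)
  have fin: "finite T" using T finite_subset by blast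
  have "i \<in> T" using T(1) i by blast
  then have "card (T - {i}) < k" using T(3) k fin by simp
  then obtain x where x: "x \<in> C" "x \<noteq> 0\<^sub>v n" "\<forall>j\<in>T - {i}. x $ j = 0"
    using mds_space_vanishing_word[OF C, of "T - {i}"] T by blast
  \<comment> \<open>Otherwise \<open>x\<close> would vanish on all \<open>k\<close> positions of
    \<open>T\<close>.\<close>
  have "x $ i \<noteq> 0"
  proof
    assume "x $ i = 0"
    then have "card T \<le> card {j. j < n \<and> x $ j = 0}" using x T by (intro card_mono) auto
    then show False using C x T by (auto simp: mds_space_def)
  qed
  \<comment> \<open>Outside \<open>T\<close> the entries of \<open>t\<close> vanish, and on
    \<open>T - {i}\<close> those of \<open>x\<close>.\<close>
  have "galois_inner p e t x = (\<Sum>j\<in>{i}. t $ j * x $ j ^ p ^ e)"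
    unfolding galois_inner_def using t i T x p by (intro sum.mono_neutral_right) auto
  then show False using orth x \<open>x $ i \<noteq> 0\<close> i by simp
qed

section \<open>Scaling one coordinate to lower the hull dimension\<close>

definition scale_coord :: "nat \<Rightarrow> 'a::times \<Rightarrow> 'a vec \<Rightarrow> 'a vec" where
  "scale_coord i c x = vec (dim_vec x) (\<lambda>j. if j = i then c * x $ j else x $ j)"

lemma scale_coord_carrier: "x \<in> carrier_vec n \<Longrightarrow> scale_coord i c x \<in> carrier_vec n"
  by (simp add: scale_coord_def)

lemma scale_coord_index:
  "x \<in> carrier_vec n \<Longrightarrow> j < n \<Longrightarrow> scale_coord i c x $ j = (if j = i then c * x $ j else x $ j)"
  by (simp add: scale_coord_def)

lemma inj_on_scale_coord:
  assumes "(c :: 'a::field) \<noteq> 0"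
  shows "inj_on (scale_coord i c) (carrier_vec n)"
proof (rule inj_onI)
  fix x y :: "'a vec"
  assume *: "x \<in> carrier_vec n" "y \<in> carrier_vec n" "scale_coord i c x = scale_coord i c y"
  show "x = y"
  proof (rule eq_vecI)
    fix j assume "j < dim_vec y"
    then show "x $ j = y $ j"
      using arg_cong[OF *(3), of "\<lambda>v. v $ j"] *(1,2) assms
      by (simp add: scale_coord_index split: if_splits)
  qed (use * in simp)
qed

lemma vec_subspace_scale_coord:
  assumes "vec_subspace n C"
  shows "vec_subspace n (scale_coord i c ` C)"
proof -
  note Cc = assms[unfolded subspace_vec_iff]
  have add: "scale_coord i c x + scale_coord i c y = scale_coord i c (x + y)"
    if "x \<in> C" "y \<in> C" for x y
  proof -
    have "x \<in> carrier_vec n" "y \<in> carrier_vec n" using that Cc by auto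
    then show ?thesis by (intro eq_vecI) (auto simp: scale_coord_def distrib_left)
  qed
  have smult: "d \<cdot>\<^sub>v scale_coord i c x = scale_coord i c (d \<cdot>\<^sub>v x)" for x d
    by (intro eq_vecI) (auto simp: scale_coord_def)
  have "0\<^sub>v n = scale_coord i c (0\<^sub>v n)" by (intro eq_vecI) (auto simp: scale_coord_def)
  then have "0\<^sub>v n \<in> scale_coord i c ` C" 
    by (rule image_eqI) (use Cc in blast)
  moreover have "scale_coord i c ` C \<subseteq> carrier_vec n" using Cc scale_coord_carrier by blast
  ultimately show ?thesis unfolding subspace_vec_iff
    using Cc by (auto simp: add smult)
qed

text \<open>A nonzero factor leaves the zeros of every word in place and is invertible, so the zero
  bound and the size of the code survive.\<close>

lemma mds_space_scale_coord:
  assumes C: "mds_space n k C" and c: "c \<noteq> 0"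
  shows "mds_space n k (scale_coord i c ` C)"
proof -
  have sub: "vec_subspace n C" and card: "card C = CARD('a) ^ k"
    and zeros: "\<And>x. x \<in> C \<Longrightarrow> x \<noteq> 0\<^sub>v n \<Longrightarrow> card {j. j < n \<and> x $ j = 0} < k"
    using C by (auto simp: mds_space_def)
  have C': "C \<subseteq> carrier_vec n" using sub by (simp add: subspace_vec_iff)
  have "card (scale_coord i c ` C) = card C"
    using inj_on_subset[OF inj_on_scale_coord[OF c] C'] by (rule card_image)
  moreover have "card {j. j < n \<and> scale_coord i c x $ j = 0} < k"
    if x: "x \<in> C" "scale_coord i c x \<noteq> 0\<^sub>v n" for x
  proof -
    have xn: "x \<in> carrier_vec n" using x C' by blast
    have "x \<noteq> 0\<^sub>v n" using x(2) by (auto simp: scale_coord_def)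
    moreover have "{j. j < n \<and> scale_coord i c x $ j = 0} = {j. j < n \<and> x $ j = 0}"
      using c by (auto simp: scale_coord_index[OF xn] split: if_splits)
    ultimately show ?thesis using zeros[OF x(1)] by simp
  qed
  ultimately show ?thesis
    using card vec_subspace_scale_coord[OF sub] by (auto simp: mds_space_def)
qed

text \<open>Only the \<open>i\<close>-th term changes, by the factor \<open>c ^ (1 + p ^ e)\<close>.
  The correction is a product of a function of \<open>y\<close> and a function of \<open>x\<close>,
  hence of rank at most one.\<close>

lemma galois_inner_scale_coord:
  assumes x: "x \<in> carrier_vec n" and y: "y \<in> carrier_vec n" and i: "i < n"
  shows "galois_inner p e (scale_coord i c y) (scale_coord i c x) =
    galois_inner p e y x + (c ^ (1 + p ^ e) - 1) * (y $ i * x $ i ^ p ^ e)"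
proof -
  have "galois_inner p e (scale_coord i c y) (scale_coord i c x) =
      (\<Sum>j<n. y $ j * x $ j ^ p ^ e
         + (if j = i then (c ^ (1 + p ^ e) - 1) * (y $ i * x $ i ^ p ^ e) else 0))"
    unfolding galois_inner_def using x y
    by (intro sum.cong) (auto simp: scale_coord_def power_mult_distrib algebra_simps)
  then show ?thesis using x y i by (simp add: galois_inner_def sum.distrib)
qed

text \<open>A vector \<open>t\<close> of the left radical with \<open>t $ i \<noteq> 0\<close> forces every vector of the new hull
  to vanish at \<open>i\<close>.\<close>

lemma galois_hull_scale_coord:
  fixes C :: "'a::{field,finite} vec set"
  assumes C: "vec_subspace n C" and i: "i < n" and \<alpha>: "\<alpha> ^ (1 + p ^ e) \<noteq> 1" and p: "p > 0"
    and t: "t \<in> C" "\<forall>x\<in>C. galois_inner p e t x = 0" "t $ i \<noteq> 0"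
  shows "galois_hull p e n (scale_coord i \<alpha> ` C) =
    scale_coord i \<alpha> ` {x \<in> galois_hull p e n C. x $ i = 0}"
proof -
  have C': "C \<subseteq> carrier_vec n" using C by (simp add: subspace_vec_iff)
  have sC': "scale_coord i \<alpha> ` C \<subseteq> carrier_vec n" using C' scale_coord_carrier by blast
  have inner: "galois_inner p e (scale_coord i \<alpha> y) (scale_coord i \<alpha> x) =
      galois_inner p e y x + (\<alpha> ^ (1 + p ^ e) - 1) * (y $ i * x $ i ^ p ^ e)"
    if "x \<in> C" "y \<in> C" for x y
    using that C' i by (intro galois_inner_scale_coord) auto
  have "(\<forall>y\<in>C. galois_inner p e (scale_coord i \<alpha> y) (scale_coord i \<alpha> x) = 0) \<longleftrightarrow>
      (\<forall>y\<in>C. galois_inner p e y x = 0) \<and> x $ i = 0" if x: "x \<in> C" for x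
  proof
    assume *: "\<forall>y\<in>C. galois_inner p e (scale_coord i \<alpha> y) (scale_coord i \<alpha> x) = 0"
    \<comment> \<open>Testing against \<open>y = t\<close> isolates the correction term, because
      \<open>t\<close> is orthogonal to \<open>C\<close> in the original form.\<close>
    then have "(\<alpha> ^ (1 + p ^ e) - 1) * (t $ i * x $ i ^ p ^ e) = 0" using inner[OF x t(1)] t x by simp
    then have x0: "x $ i = 0" using \<alpha> t(3) by simp
    have "galois_inner p e y x = 0" if "y \<in> C" for y
      using * inner[OF x that] that p by (simp add: x0 zero_power)
    then show "(\<forall>y\<in>C. galois_inner p e y x = 0) \<and> x $ i = 0" using x0 by blast
  next
    assume "(\<forall>y\<in>C. galois_inner p e y x = 0) \<and> x $ i = 0"
    then show "\<forall>y\<in>C. galois_inner p e (scale_coord i \<alpha> y) (scale_coord i \<alpha> x) = 0"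
      using inner[OF x] p by (simp add: zero_power)
  qed
  then show ?thesis
    by (auto simp: galois_hull_iff[OF sC'] galois_hull_iff[OF C'])
qed

lemma mds_hull_decrement:
  fixes C :: "'a::{field,finite} vec set"
  assumes p: "p = CHAR('a)" and C: "mds_space n k C" and k: "1 \<le> k" "k \<le> n"
    and \<alpha>: "\<alpha> \<noteq> 0" "\<alpha> ^ (1 + p ^ e) \<noteq> (1 :: 'a)"
    and hull: "card (galois_hull p e n C) = CARD('a) ^ Suc h"
  shows "\<exists>D :: 'a vec set. mds_space n k D \<and> card (galois_hull p e n D) = CARD('a) ^ h"
proof -
  let ?H = "galois_hull p e n C" and ?L = "{y \<in> C. \<forall>x\<in>C. galois_inner p e y x = 0}"
  have p0: "p > 0" using p prime_CHAR_finite[where 'a = 'a] by (simp add: prime_gt_0_nat)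
  have sub: "vec_subspace n C"
    and zeros: "\<And>x. x \<in> C \<Longrightarrow> x \<noteq> 0\<^sub>v n \<Longrightarrow> card {j. j < n \<and> x $ j = 0} < k"
    using C by (auto simp: mds_space_def)
  have C': "C \<subseteq> carrier_vec n" using sub by (simp add: subspace_vec_iff)
  have nontriv: "\<exists>x\<in>A. x \<noteq> 0\<^sub>v n" if "card A = CARD('a) ^ Suc h" for A :: "'a vec set"
  proof (rule ccontr)
    assume "\<not> ?thesis"
    then have "A \<subseteq> {0\<^sub>v n}" by blast
    then have "card A \<le> 1" using card_mono[of "{0\<^sub>v n}" A] by simp
    moreover have "1 < CARD('a) ^ Suc h" by (rule one_less_power[OF card_field_gt_1]) simp
    ultimately show False using that by simp
  qed
  obtain r where r: "r \<in> ?H" "r \<noteq> 0\<^sub>v n" using nontriv[OF hull] by blast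
  \<comment> \<open>The left radical has as many elements as the hull, so it also contains a nonzero
    word.\<close>
  obtain t where t: "t \<in> ?L" "t \<noteq> 0\<^sub>v n"
    using nontriv[of ?L] hull card_left_radical[OF p sub, of e] by auto
  have "\<exists>i<n. r $ i \<noteq> 0 \<and> t $ i \<noteq> 0"
  proof (rule ccontr)
    assume "\<not> ?thesis"
    \<comment> \<open>Disjoint supports would place the more than \<open>k\<close> support positions
      of \<open>t\<close> among the fewer than \<open>k\<close> zeros of \<open>r\<close>.\<close>
    then have "card {j. j < n \<and> t $ j \<noteq> 0} \<le> card {j. j < n \<and> r $ j = 0}"
      by (intro card_mono) auto
    moreover have "card {j. j < n \<and> r $ j = 0} < k" using zeros r by (simp add: galois_hull_iff[OF C'])
    moreover have "k < card {j. j < n \<and> t $ j \<noteq> 0}"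
      using t C' p0 by (intro mds_space_dual_support[OF C k]) auto
    ultimately show False by linarith
  qed
  then obtain i where i: "i < n" "r $ i \<noteq> 0" "t $ i \<noteq> 0" by blast
  have H: "vec_subspace n ?H" using vec_subspace_galois_hull[OF p sub] .
  let ?K = "{x \<in> ?H. x $ i = 0}"
  have "card (galois_hull p e n (scale_coord i \<alpha> ` C)) = card (scale_coord i \<alpha> ` ?K)"
    using galois_hull_scale_coord[OF sub i(1) \<alpha>(2) p0, of t] t i(3) by simp
  also have "\<dots> = card ?K"
    using H by (intro card_image inj_on_subset[OF inj_on_scale_coord[OF \<alpha>(1)], of _ n])
      (auto simp: subspace_vec_iff)
  \<comment> \<open>The hull word \<open>r\<close> is nonzero at \<open>i\<close>, so vanishing at
    \<open>i\<close> costs exactly one factor \<open>CARD('a)\<close>.\<close>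
  also have "\<dots> = CARD('a) ^ h"
    using card_coord_kernel[OF H i(1) r(1) i(2)] hull by simp
  finally show ?thesis using mds_space_scale_coord[OF C \<alpha>(1)] by blast
qed

text \<open>A decrement preserves \<open>n\<close>, \<open>k\<close> and the MDS property, and the
  same \<alpha> serves each time, so it can be iterated from \<open>h\<close> down to
  \<open>s\<close>.\<close>

lemma mds_hull_reduction:
  fixes C :: "'a::{field,finite} vec set"
  assumes p: "p = CHAR('a)" and C: "mds_space n k C" and k: "1 \<le> k" "k \<le> n"
    and \<alpha>: "\<alpha> \<noteq> 0" "\<alpha> ^ (1 + p ^ e) \<noteq> (1 :: 'a)"
    and hull: "card (galois_hull p e n C) = CARD('a) ^ h" and s: "s \<le> h"
  shows "\<exists>D :: 'a vec set. mds_space n k D \<and> card (galois_hull p e n D) = CARD('a) ^ s"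
  using s
proof (induction s rule: inc_induct)
  case base
  then show ?case using C hull by blast
next
  case (step s)
  then show ?case using mds_hull_decrement[OF p _ k \<alpha>] by blast
qed

text \<open>Otherwise all \<open>p ^ m - 1\<close> nonzero elements are roots of a polynomial of
  degree at most \<open>1 + p ^ e\<close>, whence \<open>p ^ m \<le> 2 + p ^ (m - 1)\<close>. As
  \<open>p ^ m\<close> is at least twice \<open>p ^ (m - 1)\<close>, this forces
  \<open>p ^ m \<le> 4\<close>.\<close>

lemma exists_power_neq_one:
  assumes "prime p" and q: "CARD('a::{field,finite}) = p ^ m" and "p ^ m > 4" and "e \<le> m - 1"
  shows "\<exists>\<alpha>::'a. \<alpha> \<noteq> 0 \<and> \<alpha> ^ (1 + p ^ e) \<noteq> 1"
proof (rule ccontr)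
  assume *: "\<not> ?thesis"
  let ?f = "Polynomial.monom 1 (1 + p ^ e) - 1 :: 'a poly"
  have p2: "p \<ge> 2" using assms(1) by (rule prime_ge_2_nat)
  have "Polynomial.coeff ?f (1 + p ^ e) = 1" by simp
  then have f0: "?f \<noteq> 0" by (metis coeff_0 zero_neq_one)
  have "UNIV - {0} \<subseteq> {x. poly ?f x = 0}" using * by (auto simp: poly_monom)
  then have "card (UNIV - {0 :: 'a}) \<le> card {x. poly ?f x = 0}" by (intro card_mono) auto
  also have "\<dots> \<le> degree ?f" using f0 by (rule card_poly_roots_bound)
  also have "\<dots> \<le> 1 + p ^ e" by (intro degree_diff_le) (auto simp: degree_monom_le)
  also have "p ^ e \<le> p ^ (m - 1)" using assms(4) p2 by (intro power_increasing) auto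
  finally have 1: "p ^ m \<le> 2 + p ^ (m - 1)" using q by (simp add: card_Diff_singleton)
  have "m \<noteq> 0" using assms(3) by (intro notI) simp
  then have "p ^ m = p * p ^ (m - 1)" by (cases m) auto
  moreover have "2 * p ^ (m - 1) \<le> p * p ^ (m - 1)" using p2 by simp
  ultimately show False using 1 assms(3) by linarith
qed

section \<open>Extended GRS codes and their hulls\<close>

lemma card_poly_degree_le:
  "card {f :: 'a::{field,finite} poly. degree f \<le> d} = CARD('a) ^ Suc d"
proof -
  have "bij_betw (\<lambda>f. restrict (Polynomial.coeff f) {..d}) {f :: 'a poly. degree f \<le> d} ({..d} \<rightarrow>\<^sub>E UNIV)"
    unfolding bij_betw_def
  proof
    show "inj_on (\<lambda>f. restrict (Polynomial.coeff f) {..d}) {f :: 'a poly. degree f \<le> d}"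
    proof (rule inj_onI)
      fix f g :: "'a poly"
      assume *: "f \<in> {f. degree f \<le> d}" "g \<in> {f. degree f \<le> d}"
        "restrict (Polynomial.coeff f) {..d} = restrict (Polynomial.coeff g) {..d}"
      show "f = g"
      proof (rule poly_eqI)
        fix i show "Polynomial.coeff f i = Polynomial.coeff g i"
        proof (cases "i \<le> d")
          case True
          then show ?thesis using fun_cong[OF *(3), of i] by simp
        next
          case False
          then show ?thesis using *(1,2) by (simp add: coeff_eq_0)
        qed
      qed
    qed
    show "(\<lambda>f. restrict (Polynomial.coeff f) {..d}) ` {f :: 'a poly. degree f \<le> d} = {..d} \<rightarrow>\<^sub>E UNIV"
    proof (intro equalityI subsetI)
      fix h :: "nat \<Rightarrow> 'a" assume h: "h \<in> {..d} \<rightarrow>\<^sub>E UNIV"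
      let ?f = "\<Sum>i\<le>d. Polynomial.monom (h i) i"
      have "degree ?f \<le> d"
        by (rule degree_sum_le) (auto intro: order_trans[OF degree_monom_le])
      moreover have "restrict (Polynomial.coeff ?f) {..d} = h"
      proof
        fix i show "restrict (Polynomial.coeff ?f) {..d} i = h i"
        proof (cases "i \<le> d")
          case True
          then show ?thesis by (simp add: coeff_sum sum.delta)
        next
          case False
          then show ?thesis using PiE_arb[OF h] by simp
        qed
      qed
      ultimately show "h \<in> (\<lambda>f. restrict (Polynomial.coeff f) {..d}) ` {f :: 'a poly. degree f \<le> d}"
        by (intro image_eqI[of _ _ ?f]) auto
    qed (auto split: if_splits)
  qed
  from bij_betw_same_card[OF this] show ?thesis by (simp add: card_PiE)
qed

text \<open>The last coordinate is the evaluation at infinity, i.e. the coefficient of degree \<open>k - 1\<close>.\<close>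

definition ext_grs_word ::
  "nat \<Rightarrow> nat \<Rightarrow> (nat \<Rightarrow> 'a::field) \<Rightarrow> (nat \<Rightarrow> 'a) \<Rightarrow> 'a poly \<Rightarrow> 'a vec" where
  "ext_grs_word M k a v f =
     vec (Suc M) (\<lambda>j. if j = M then Polynomial.coeff f (k - 1) else v j * poly f (a j))"

text \<open>A zero at infinity is paid for by a drop in degree. If the coefficient of degree
  \<open>k - 1\<close> vanishes, \<open>f\<close> has at most \<open>k - 2\<close> roots; otherwise
  it has at most \<open>k - 1\<close> and the last entry is nonzero.\<close>

lemma ext_grs_word_zeros:
  assumes a: "inj_on a {..<M}" and v: "\<And>j. j < M \<Longrightarrow> v j \<noteq> 0"
    and f: "f \<noteq> 0" "degree f \<le> k - 1" and k: "1 \<le> k"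
  shows "card {j. j < Suc M \<and> ext_grs_word M k a v f $ j = 0} < k"
proof -
  let ?Z = "{j. j < M \<and> poly f (a j) = 0}"
  let ?S = "{j. j < Suc M \<and> ext_grs_word M k a v f $ j = 0}"
  have "card ?Z = card (a ` ?Z)"
    by (intro card_image[symmetric] inj_on_subset[OF a]) auto
  also have "\<dots> \<le> card {x. poly f x = 0}"
    using poly_roots_finite[OF f(1)] by (intro card_mono) auto
  also have "\<dots> \<le> degree f" using f(1) by (rule card_poly_roots_bound)
  finally have Z: "card ?Z \<le> degree f" .
  have S: "?S \<subseteq> insert M ?Z" using v by (auto simp: ext_grs_word_def less_Suc_eq)
  show ?thesis
  proof (cases "Polynomial.coeff f (k - 1) = 0")
    case True
    then have "degree f \<noteq> k - 1" using f(1) leading_coeff_0_iff by metis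
    moreover have "card ?S \<le> card (insert M ?Z)" using S by (intro card_mono) auto
    ultimately show ?thesis using Z f(2) by (simp add: card_insert_if)
  next
    case False
    then have "?S \<subseteq> ?Z" using S by (auto simp: ext_grs_word_def)
    then have "card ?S \<le> card ?Z" by (intro card_mono) auto
    then show ?thesis using Z f(2) k by linarith
  qed
qed

text \<open>The bound on zeros serves twice: it is the MDS condition, and it makes the encoding
  injective, since two polynomials with the same word would have a difference whose word has
  \<open>Suc M \<ge> k\<close> zeros.\<close>

lemma mds_space_ext_grs:
  fixes a v :: "nat \<Rightarrow> 'a::{field,finite}"
  assumes a: "inj_on a {..<M}" and v: "\<And>j. j < M \<Longrightarrow> v j \<noteq> 0" and k: "1 \<le> k" "k \<le> Suc M"
  shows "mds_space (Suc M) k (ext_grs_word M k a v ` {f. degree f \<le> k - 1})"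
proof -
  let ?P = "{f :: 'a poly. degree f \<le> k - 1}" and ?w = "ext_grs_word M k a v"
  have add: "?w f + ?w g = ?w (f + g)" for f g
    by (intro eq_vecI) (auto simp: ext_grs_word_def distrib_left)
  have smult: "c \<cdot>\<^sub>v ?w f = ?w (Polynomial.smult c f)" for c f
    by (intro eq_vecI) (auto simp: ext_grs_word_def)
  have zero: "0\<^sub>v (Suc M) = ?w 0" by (intro eq_vecI) (auto simp: ext_grs_word_def)
  have "inj_on ?w ?P"
  proof (rule inj_onI, rule ccontr)
    fix f g assume *: "f \<in> ?P" "g \<in> ?P" "?w f = ?w g" "f \<noteq> g"
    have "?w (f - g) $ j = 0" if "j < Suc M" for j
      using arg_cong[OF *(3), of "\<lambda>x. x $ j"] that by (simp add: ext_grs_word_def right_diff_distrib split: if_splits)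
    then have "{j. j < Suc M \<and> ?w (f - g) $ j = 0} = {..<Suc M}" by auto
    moreover have "card {j. j < Suc M \<and> ?w (f - g) $ j = 0} < k"
      using * k by (intro ext_grs_word_zeros[OF a v]) (auto intro: degree_diff_le)
    ultimately show False using k by simp
  qed
  then have "card (?w ` ?P) = CARD('a) ^ k"
    using card_poly_degree_le[where 'a = 'a, of "k - 1"] k by (simp add: card_image)
  moreover have "card {j. j < Suc M \<and> ?w f $ j = 0} < k"
    if "f \<in> ?P" "?w f \<noteq> 0\<^sub>v (Suc M)" for f
    using that zero k by (intro ext_grs_word_zeros[OF a v]) auto
  moreover have "vec_subspace (Suc M) (?w ` ?P)"
    unfolding subspace_vec_iff
  proof (intro conjI ballI allI)
    show "?w ` ?P \<subseteq> carrier_vec (Suc M)" by (auto simp: ext_grs_word_def)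
    show "0\<^sub>v (Suc M) \<in> ?w ` ?P" unfolding zero by (rule imageI) simp
  next
    fix x y assume "x \<in> ?w ` ?P" "y \<in> ?w ` ?P"
    then show "x + y \<in> ?w ` ?P" by (auto simp: add intro: degree_add_le)
  next
    fix c x assume "x \<in> ?w ` ?P"
    then show "c \<cdot>\<^sub>v x \<in> ?w ` ?P" by (auto simp: smult intro: order_trans[OF degree_smult_le])
  qed
  ultimately show ?thesis unfolding mds_space_def by blast
qed

text \<open>The words of \<open>D\<close> that extend a hull word of the punctured code \<open>C\<close> by zeros lie in the hull
  of \<open>D\<close>, so each new coordinate costs at most one dimension.\<close>

lemma card_hull_extension:
  fixes D :: "'a::{field,finite} vec set"
  assumes p: "p = CHAR('a)" and D: "vec_subspace (n + i) D" and C: "vec_subspace n C"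
    and C_eq: "C = (\<lambda>x. vec n (\<lambda>j. x $ j)) ` D"
  shows "card (galois_hull p e n C) \<le> CARD('a) ^ i * card (galois_hull p e (n + i) D)"
proof -
  let ?\<pi> = "\<lambda>x :: 'a vec. vec n (\<lambda>j. x $ j)"
  let ?H = "galois_hull p e n C"
  let ?W = "{x \<in> D. ?\<pi> x \<in> ?H}"
  have p0: "p > 0" using p prime_CHAR_finite[where 'a = 'a] by (simp add: prime_gt_0_nat)
  note Dc = D[unfolded subspace_vec_iff]
  have D': "D \<subseteq> carrier_vec (n + i)" and C': "C \<subseteq> carrier_vec n"
    using D C by (auto simp: subspace_vec_iff)
  note Hc = vec_subspace_galois_hull[OF p C, of e, unfolded subspace_vec_iff]
  have add: "?\<pi> (x + y) = ?\<pi> x + ?\<pi> y" if "x \<in> D" "y \<in> D" for x y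
  proof -
    have "dim_vec y = n + i" using that D' by auto
    then show ?thesis by (intro eq_vecI) auto
  qed
  have smult: "?\<pi> (c \<cdot>\<^sub>v x) = c \<cdot>\<^sub>v ?\<pi> x" if "x \<in> D" for c x
  proof -
    have "dim_vec x = n + i" using that D' by auto
    then show ?thesis by (intro eq_vecI) auto
  qed
  have zero: "?\<pi> (0\<^sub>v (n + i)) = 0\<^sub>v n" by (intro eq_vecI) auto
  have W: "vec_subspace (n + i) ?W"
    using Dc Hc by (auto simp: subspace_vec_iff add smult zero)
  have "?H \<subseteq> ?\<pi> ` ?W"
  proof
    fix x assume x: "x \<in> ?H"
    then have "x \<in> C" using galois_hull_iff[OF C'] by blast
    then obtain y where "y \<in> D" "x = ?\<pi> y" unfolding C_eq by blast
    then show "x \<in> ?\<pi> ` ?W" using x by blast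
  qed
  then have "card ?H \<le> card ?W"
    using vec_subspace_finite[OF W] surj_card_le by blast
  \<comment> \<open>Among the words lying over the hull of \<open>C\<close>, those whose
    \<open>i\<close> appended entries vanish are kept.\<close>
  also have "\<dots> \<le> CARD('a) ^ card {n..<n + i} * card {x \<in> ?W. \<forall>j\<in>{n..<n + i}. x $ j = 0}"
    by (rule card_vanishing[OF W]) auto
  also have "card {x \<in> ?W. \<forall>j\<in>{n..<n + i}. x $ j = 0} \<le> card (galois_hull p e (n + i) D)"
  proof (rule card_mono)
    show "finite (galois_hull p e (n + i) D)"
      by (rule vec_subspace_finite[OF vec_subspace_galois_hull[OF p D]])
    show "{x \<in> ?W. \<forall>j\<in>{n..<n + i}. x $ j = 0} \<subseteq> galois_hull p e (n + i) D"
    proof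
      fix x assume x: "x \<in> {x \<in> ?W. \<forall>j\<in>{n..<n + i}. x $ j = 0}"
      have "galois_inner p e y x = 0" if y: "y \<in> D" for y
      proof -
        have dim: "dim_vec y = n + i" using y D' by auto
        \<comment> \<open>The appended entries of \<open>x\<close> are zero, so only the first
          \<open>n\<close> terms contribute.\<close>
        have "galois_inner p e y x = (\<Sum>j<n. y $ j * x $ j ^ p ^ e)"
          unfolding galois_inner_def dim using x p0
          by (intro sum.mono_neutral_right) (auto simp: zero_power)
        also have "\<dots> = galois_inner p e (?\<pi> y) (?\<pi> x)" by (simp add: galois_inner_def)
        also have "\<dots> = 0" using x y galois_hull_iff[OF C', of "?\<pi> x"] C_eq by blast
        finally show ?thesis .
      qed
      then show "x \<in> galois_hull p e (n + i) D" using x by (simp add: galois_hull_iff[OF D'])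
    qed
  qed
  finally show ?thesis by simp
qed

section \<open>Additional evaluation points and the final construction\<close>

text \<open>The \<open>CARD('a) - n\<close> values not yet taken suffice for the
  \<open>M - n\<close> new indices.\<close>

lemma inj_on_extend:
  fixes a :: "nat \<Rightarrow> 'a::finite"
  assumes a: "inj_on a {..<n}" and "n \<le> M" "M \<le> CARD('a)"
  shows "\<exists>b. inj_on b {..<M} \<and> (\<forall>j<n. b j = a j)"
proof -
  have "card {n..<M} \<le> card (UNIV - a ` {..<n})"
    using assms by (simp add: card_Diff_subset card_image)
  then obtain g where g: "inj_on g {n..<M}" "g ` {n..<M} \<subseteq> UNIV - a ` {..<n}"
    using card_le_inj[of "{n..<M}" "UNIV - a ` {..<n}"] by auto
  have "inj_on (\<lambda>j. if j < n then a j else g j) {..<M}"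
  proof (rule inj_onI)
    fix x y assume xy: "x \<in> {..<M}" "y \<in> {..<M}"
      "(if x < n then a x else g x) = (if y < n then a y else g y)"
    have ne: "a u \<noteq> g w" if "u < n" "\<not> w < n" "w < M" for u w using that g(2) by force
    show "x = y"
    proof (cases "x < n"; cases "y < n")
      assume "x < n" "y < n"
      then show ?thesis using xy inj_onD[OF a, of x y] by simp
    next
      assume "\<not> x < n" "\<not> y < n"
      then show ?thesis using xy inj_onD[OF g(1), of x y] by simp
    next
      assume "x < n" "\<not> y < n"
      then show ?thesis using xy ne[of x y] by simp
    next
      assume "\<not> x < n" "y < n"
      then show ?thesis using xy ne[of y x] by simp
    qed
  qed
  then show ?thesis by (intro exI[of _ "\<lambda>j. if j < n then a j else g j"]) auto
qed

theorem corollary3: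
  fixes p m e n k l :: nat
  assumes "prime p"
    and "card (UNIV :: 'a::{field,finite} set) = p ^ m"
    and "p ^ m > 4"
    and "e \<le> m - 1"
    and "l \<le> k"
    and "\<exists>C :: 'a vec set. grs_code n k C \<and> code_dim n (galois_hull p e n C) = l"
  shows "\<forall>i s. 1 \<le> i \<and> i \<le> min l (p ^ m + 1 - n) \<and> s \<le> l - i \<longrightarrow>
    (\<exists>D :: 'a vec set. mds_code (n + i) k D \<and>
       code_dim (n + i) (galois_hull p e (n + i) D) = s)"
proof (intro allI impI)
  fix i s assume bounds: "1 \<le> i \<and> i \<le> min l (p ^ m + 1 - n) \<and> s \<le> l - i"
  let ?q = "CARD('a)"
  have p: "p = CHAR('a)" using CHAR_eq_of_card[OF assms(1,2)] by simp
  obtain C :: "'a vec set" where grs: "grs_code n k C" and l: "code_dim n (galois_hull p e n C) = l"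
    using assms(6) by blast
  from grs obtain a v :: "nat \<Rightarrow> 'a" where k: "1 \<le> k" "k \<le> n"
    and a: "inj_on a {..<n}" and v: "\<forall>j<n. v j \<noteq> 0"
    and C: "C = {vec n (\<lambda>j. v j * poly f (a j)) | f. degree f \<le> k - 1}"
    unfolding grs_code_def by blast
  \<comment> \<open>\<open>M\<close> counts the affine points, and the point at infinity takes the
    last index \<open>M\<close>. The bound \<open>i \<le> p ^ m + 1 - n\<close> thus says that the
    field has enough elements for the affine points.\<close>
  define M where "M = n + i - 1"
  have M: "Suc M = n + i" "n \<le> M" "M \<le> ?q" using bounds assms(2) by (auto simp: M_def)
  obtain b where b: "inj_on b {..<M}" "\<forall>j<n. b j = a j"
    using inj_on_extend[OF a M(2,3)] by blast
  \<comment> \<open>The new affine coordinates only need nonzero multipliers; \<open>1\<close> is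
    chosen.\<close>
  define w where "w j = (if j < n then v j else 1)" for j
  have w: "w j \<noteq> 0" for j using v by (simp add: w_def)
  define D where "D = ext_grs_word M k b w ` {f. degree f \<le> k - 1}"
  have D: "mds_space (n + i) k D"
    using mds_space_ext_grs[OF b(1) w k(1)] k M unfolding D_def by simp
  then have Dsub: "vec_subspace (n + i) D" by (simp add: mds_space_def)
  \<comment> \<open>Since \<open>n \<le> M\<close>, the entry at infinity is not among the first
    \<open>n\<close>, and restricting to these recovers \<open>C\<close>.\<close>
  have "vec n (\<lambda>j. ext_grs_word M k b w f $ j) = vec n (\<lambda>j. v j * poly f (a j))" for f
    using M b(2) by (intro eq_vecI) (auto simp: ext_grs_word_def w_def)
  then have C_eq: "C = (\<lambda>x. vec n (\<lambda>j. x $ j)) ` D"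
    unfolding C D_def by (auto simp: image_image)
  have Csub: "vec_subspace n C"
    unfolding subspace_vec_iff
  proof (intro conjI ballI allI)
    show "C \<subseteq> carrier_vec n" using C by auto
    show "0\<^sub>v n \<in> C" unfolding C by (rule CollectI, rule exI[of _ 0]) auto
  next
    fix x y assume "x \<in> C" "y \<in> C"
    then obtain f g where fg: "degree f \<le> k - 1" "x = vec n (\<lambda>j. v j * poly f (a j))"
      "degree g \<le> k - 1" "y = vec n (\<lambda>j. v j * poly g (a j))" unfolding C by blast
    then show "x + y \<in> C" unfolding C
      by (intro CollectI exI[of _ "f + g"]) (auto simp: distrib_left intro: degree_add_le)
  next
    fix c x assume "x \<in> C"
    then obtain f where "degree f \<le> k - 1" "x = vec n (\<lambda>j. v j * poly f (a j))" unfolding C by blast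
    then show "c \<cdot>\<^sub>v x \<in> C" unfolding C
      by (intro CollectI exI[of _ "Polynomial.smult c f"]) (auto intro: order_trans[OF degree_smult_le])
  qed
  define h where "h = code_dim (n + i) (galois_hull p e (n + i) D)"
  have hull: "card (galois_hull p e (n + i) D) = ?q ^ h"
    unfolding h_def by (rule card_vec_subspace[OF vec_subspace_galois_hull[OF p Dsub]])
  have "?q ^ l = card (galois_hull p e n C)"
    using card_vec_subspace[OF vec_subspace_galois_hull[OF p Csub]] l by simp
  \<comment> \<open>At most one factor \<open>CARD('a)\<close> is lost per appended coordinate, so
    \<open>h\<close> is at least \<open>l - i\<close> and hence at least \<open>s\<close>.\<close>
  also have "\<dots> \<le> ?q ^ (i + h)"
    using card_hull_extension[OF p Dsub Csub C_eq, of e] hull by (simp add: power_add)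
  finally have "l \<le> i + h" using card_field_gt_1[where 'a = 'a] by simp
  then have "s \<le> h" using bounds by linarith
  moreover obtain \<alpha> :: 'a where "\<alpha> \<noteq> 0" "\<alpha> ^ (1 + p ^ e) \<noteq> 1"
    using exists_power_neq_one[OF assms(1-4)] by blast
  moreover have kn: "k \<le> n + i" using k by simp
  ultimately obtain E :: "'a vec set" where E: "mds_space (n + i) k E"
    "card (galois_hull p e (n + i) E) = ?q ^ s"
    using mds_hull_reduction[OF p D k(1) kn _ _ hull] by blast
  have "vec_subspace (n + i) E" using E(1) by (simp add: mds_space_def)
  then have "code_dim (n + i) (galois_hull p e (n + i) E) = s"
    using code_dim_eqI[OF vec_subspace_galois_hull[OF p] E(2)] by blast
  then show "\<exists>D :: 'a vec set. mds_code (n + i) k D \<and> code_dim (n + i) (galois_hull p e (n + i) D) = s"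
    using mds_code_of_mds_space[OF E(1) k(1) kn] by blast
qed

end
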